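(* Let $(X,\leq)$ be a poset, $C$ a closure operator on $X$, and $(L,\leq)$ a complete lattice. For each up-set $T$ of the poset $X/C$ let $S_T=\bigcup_{[x]\in T}[x]\subseteq X$, and let $\mathcal{S}=\{S_T\mid T\in\mathcal{F}_{X/C}\}$. Suppose there exists a closure operator $C_1$ on $L$ such that $L/C_1$ is order isomorphic to $F_X=(\mathcal{F}_X,\supseteq)$. Then $(\mathcal{F}^u_L(X/C)/\sim,\leq)\cong[0,[\mu]_\sim]$, where $0$ is the bottom element of the lattice $(\mathcal{F}^u_L(X)/\sim,\leq)$ and $\mu\in\mathcal{F}^u_L(X)$ satisfies $\mu_L=\mathcal{S}$.
   Context: A closure operator on a poset $P$ is a map $C:P\to P$ with $p\leq C(p)$, $p\leq q\Rightarrow C(p)\leq C(q)$, $C(C(p))=C(p)$; $P/C$ is the set of equivalence classes $[x]$ of $x\sim' y\iff C(x)=C(y)$, ordered by $[x]\leq[y]$ iff $C(x)\leq C(y)$. For a poset $Y$, an up-set is a subset $U$ with $x\in U$, $x\leq y\Rightarrow y\in U$; $\mathcal{F}_Y$ is the set of all up-sets of $Y$ and $F_Y=(\mathcal{F}_Y,\supseteq)$. An $L$-fuzzy up-set on a poset $Y$ is a map $\mu:Y\to L$ with $x\leq y\Rightarrow\mu(x)\leq\mu(y)$; $\mathcal{F}^u_L(Y)$ is the set of all of them. For $p\in L$, $\mu_p=\{y\in Y\mid\mu(y)\geq p\}$ and $\mu_L=\{\mu_p\mid p\in L\}$. On $\mathcal{F}^u_L(Y)$, $\mu\sim\nu$ iff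 $\mu_L=\nu_L$, and $[\mu]_\sim\leq[\nu]_\sim$ iff $\mu_L\subseteq\nu_L$. $[0,[\mu]_\sim]$ denotes the interval $\{a\in\mathcal{F}^u_L(X)/\sim \mid 0\leq a\leq[\mu]_\sim\}$.
   Formalization: The ordered set of classes of L-fuzzy up-sets on X is treated only as a poset with a bottom element 0, not as a lattice, since it can fail to be one (e.g. X a 4-element antichain, L = 2^4, C_1 the identity). *)

theory Defs
  imports "HOL-Algebra.Complete_Lattice" "HOL-Library.FuncSet"
begin

definition closure_operator :: "('a, 'm) gorder_scheme \<Rightarrow> ('a \<Rightarrow> 'a) \<Rightarrow> bool" where
  "closure_operator P C \<longleftrightarrow>
     C \<in> carrier P \<rightarrow> carrier P \<and>
     (\<forall>p\<in>carrier P. p \<sqsubseteq>\<^bsub>P\<^esub> C p) \<and> Mono\<^bsub>P\<^esub> C \<and> Idem\<^bsub>P\<^esub> C"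

definition closure_rel :: "('a, 'm) gorder_scheme \<Rightarrow> ('a \<Rightarrow> 'a) \<Rightarrow> ('a \<times> 'a) set" where
  "closure_rel P C = {(x, y). x \<in> carrier P \<and> y \<in> carrier P \<and> C x = C y}"

text \<open>The order does not depend on the chosen representatives, see
  \<open>closure_quotient_le_iff\<close> below.\<close>

definition closure_quotient :: "('a, 'm) gorder_scheme \<Rightarrow> ('a \<Rightarrow> 'a) \<Rightarrow> 'a set gorder" where
  "closure_quotient P C =
     \<lparr> carrier = carrier P // closure_rel P C,
       eq = (=),
       le = (\<lambda>A B. \<exists>x\<in>A. \<exists>y\<in>B. C x \<sqsubseteq>\<^bsub>P\<^esub> C y) \<rparr>"

definition up_sets :: "('a, 'm) gorder_scheme \<Rightarrow> 'a set set" where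
  "up_sets Y =
     {U. U \<subseteq> carrier Y \<and> (\<forall>x\<in>U. \<forall>y\<in>carrier Y. x \<sqsubseteq>\<^bsub>Y\<^esub> y \<longrightarrow> y \<in> U)}"

definition up_set_order :: "('a, 'm) gorder_scheme \<Rightarrow> 'a set gorder" where
  "up_set_order Y = \<lparr> carrier = up_sets Y, eq = (=), le = (\<supseteq>) \<rparr>"

definition order_isomorphic :: "('a, 'm) gorder_scheme \<Rightarrow> ('b, 'n) gorder_scheme \<Rightarrow> bool" where
  "order_isomorphic P Q \<longleftrightarrow> (\<exists>f. bij_betw f (carrier P) (carrier Q) \<and> order_emb P Q f)"

definition fuzzy_up_sets ::
  "('l, 'm) gorder_scheme \<Rightarrow> ('a, 'n) gorder_scheme \<Rightarrow> ('a \<Rightarrow> 'l) set" where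
  "fuzzy_up_sets L Y = {\<mu> \<in> carrier Y \<rightarrow>\<^sub>E carrier L. isotone Y L \<mu>}"

definition cut ::
  "('l, 'm) gorder_scheme \<Rightarrow> ('a, 'n) gorder_scheme \<Rightarrow> ('a \<Rightarrow> 'l) \<Rightarrow> 'l \<Rightarrow> 'a set" where
  "cut L Y \<mu> p = {y \<in> carrier Y. p \<sqsubseteq>\<^bsub>L\<^esub> \<mu> y}"

definition cuts ::
  "('l, 'm) gorder_scheme \<Rightarrow> ('a, 'n) gorder_scheme \<Rightarrow> ('a \<Rightarrow> 'l) \<Rightarrow> 'a set set" where
  "cuts L Y \<mu> = cut L Y \<mu> ` carrier L"

definition fuzzy_rel ::
  "('l, 'm) gorder_scheme \<Rightarrow> ('a, 'n) gorder_scheme \<Rightarrow> (('a \<Rightarrow> 'l) \<times> ('a \<Rightarrow> 'l)) set" where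
  "fuzzy_rel L Y =
     {(\<mu>, \<nu>). \<mu> \<in> fuzzy_up_sets L Y \<and> \<nu> \<in> fuzzy_up_sets L Y \<and> cuts L Y \<mu> = cuts L Y \<nu>}"

abbreviation fuzzy_class ::
  "('l, 'm) gorder_scheme \<Rightarrow> ('a, 'n) gorder_scheme \<Rightarrow> ('a \<Rightarrow> 'l) \<Rightarrow> ('a \<Rightarrow> 'l) set" where
  "fuzzy_class L Y \<mu> \<equiv> fuzzy_rel L Y `` {\<mu>}"

definition fuzzy_quotient ::
  "('l, 'm) gorder_scheme \<Rightarrow> ('a, 'n) gorder_scheme \<Rightarrow> ('a \<Rightarrow> 'l) set gorder" where
  "fuzzy_quotient L Y =
     \<lparr> carrier = fuzzy_up_sets L Y // fuzzy_rel L Y,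
       eq = (=),
       le = (\<lambda>A B. \<exists>\<mu>\<in>A. \<exists>\<nu>\<in>B. cuts L Y \<mu> \<subseteq> cuts L Y \<nu>) \<rparr>"

definition interval_order :: "'a gorder \<Rightarrow> 'a \<Rightarrow> 'a \<Rightarrow> 'a gorder" where
  "interval_order P a b = P\<lparr> carrier := \<lbrace>a..b\<rbrace>\<^bsub>P\<^esub> \<rparr>"

text \<open>Elements of the quotient are the classes themselves, so the union of all classes
  belonging to \<open>T\<close> is \<open>\<Union>T\<close>.\<close>

definition saturated_up_sets :: "('a, 'm) gorder_scheme \<Rightarrow> ('a \<Rightarrow> 'a) \<Rightarrow> 'a set set" where
  "saturated_up_sets X C = {\<Union>T | T. T \<in> up_sets (closure_quotient X C)}"

lemma closure_quotient_le_iff: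
  assumes "x \<in> carrier P" "y \<in> carrier P"
  shows "closure_rel P C `` {x} \<sqsubseteq>\<^bsub>closure_quotient P C\<^esub> closure_rel P C `` {y}
           \<longleftrightarrow> C x \<sqsubseteq>\<^bsub>P\<^esub> C y"
  using assms by (force simp: closure_quotient_def closure_rel_def)

lemma fuzzy_quotient_le_iff:
  assumes "\<mu> \<in> fuzzy_up_sets L Y" "\<nu> \<in> fuzzy_up_sets L Y"
  shows "fuzzy_class L Y \<mu> \<sqsubseteq>\<^bsub>fuzzy_quotient L Y\<^esub> fuzzy_class L Y \<nu>
           \<longleftrightarrow> cuts L Y \<mu> \<subseteq> cuts L Y \<nu>"
  using assms by (force simp: fuzzy_quotient_def fuzzy_rel_def)

lemma partial_order_closure_quotient:
  assumes "partial_order P" and "closure_operator P C"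
  shows "partial_order (closure_quotient P C)"
proof -
  interpret P: partial_order P by fact
  have C: "C x \<in> carrier P" if "x \<in> carrier P" for x
    using assms(2) that by (auto simp: closure_operator_def)
  have le: "a \<sqsubseteq>\<^bsub>closure_quotient P C\<^esub> b \<longleftrightarrow> C x \<sqsubseteq>\<^bsub>P\<^esub> C y"
    if "a = closure_rel P C `` {x}" "b = closure_rel P C `` {y}" "x \<in> carrier P" "y \<in> carrier P"
    for a b x y
    using closure_quotient_le_iff[of x P y C] that by simp
  have ex: "\<exists>x\<in>carrier P. a = closure_rel P C `` {x}" if "a \<in> carrier (closure_quotient P C)" for a
    using that by (auto simp: closure_quotient_def quotient_def)
  have eq: "eq (closure_quotient P C) = (=)" by (simp add: closure_quotient_def)
  show ?thesis
  proof (unfold_locales, unfold eq)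
    fix a assume "a \<in> carrier (closure_quotient P C)"
    then show "a \<sqsubseteq>\<^bsub>closure_quotient P C\<^esub> a" using ex[of a] le C by auto
  next
    fix a b
    assume "a \<sqsubseteq>\<^bsub>closure_quotient P C\<^esub> b" "b \<sqsubseteq>\<^bsub>closure_quotient P C\<^esub> a"
      "a \<in> carrier (closure_quotient P C)" "b \<in> carrier (closure_quotient P C)"
    then obtain x y where xy: "x \<in> carrier P" "y \<in> carrier P"
        "a = closure_rel P C `` {x}" "b = closure_rel P C `` {y}"
        "C x \<sqsubseteq>\<^bsub>P\<^esub> C y" "C y \<sqsubseteq>\<^bsub>P\<^esub> C x"
      using ex le by metis
    then have "C x = C y" using C by (intro P.le_antisym) auto
    then show "a = b" using xy by (auto simp: closure_rel_def)
  next
    fix a b c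
    assume "a \<sqsubseteq>\<^bsub>closure_quotient P C\<^esub> b" "b \<sqsubseteq>\<^bsub>closure_quotient P C\<^esub> c"
      "a \<in> carrier (closure_quotient P C)" "b \<in> carrier (closure_quotient P C)"
      "c \<in> carrier (closure_quotient P C)"
    then show "a \<sqsubseteq>\<^bsub>closure_quotient P C\<^esub> c"
      using ex le C P.le_trans by (smt (verit))
  qed auto
qed

end

theory Submission
  imports Defs "HOL-Algebra.Galois_Connection"
begin

text \<open>
  Only two properties of the projection \<open>f: X \<rightarrow> X/C\<close> matter: it is isotone and surjective.  Up to
  equivalence a fuzzy up-set is its family of cuts, and pulling back along \<open>f\<close> replaces each cut by
  its preimage.  A fuzzy up-set on \<open>X\<close> is a pullback iff its cuts are preimages of up-sets, that
  is, iff its class lies below \<open>[\<mu>]\<close>; comparing families of cuts gives the isomorphism.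

  For the existence of \<open>\<mu>\<close>, a coretract (a Galois connection whose lower adjoint is surjective)
  from \<open>L\<close> to \<open>M\<close> turns \<open>M\<close>-fuzzy up-sets into \<open>L\<close>-fuzzy up-sets with the same cuts.  The map
  sending a point of \<open>Y = X/C\<close> to the up-set it generates is an \<open>F\<^sub>Y\<close>-fuzzy up-set on \<open>Y\<close>, and
  every up-set of \<open>Y\<close> is one of its cuts.  There are coretracts from \<open>L\<close> to \<open>F\<^sub>X\<close>, by the
  hypothesis on \<open>C\<^sub>1\<close>, and from \<open>F\<^sub>X\<close> to \<open>F\<^sub>Y\<close>, with upper adjoint the preimage under \<open>f\<close>.
  Pulling the resulting \<open>L\<close>-fuzzy up-set back to \<open>X\<close> yields \<open>\<mu>\<close>.
\<close>

locale order_representation =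
  fixes P :: "('a, 'm) gorder_scheme" (structure) and f :: "'a \<Rightarrow> 'b::order"
  assumes eq_equality: "(.=) = (=)"
    and inj: "inj_on f (carrier P)"
    and le_iff: "x \<in> carrier P \<Longrightarrow> y \<in> carrier P \<Longrightarrow> x \<sqsubseteq> y \<longleftrightarrow> f x \<le> f y"

sublocale order_representation \<subseteq> partial_order P
  using inj by unfold_locales (auto simp: eq_equality le_iff inj_on_def intro: order.trans)

context order_representation
begin

lemma order_representation_subset:
  assumes "A \<subseteq> carrier P"
  shows "order_representation (P\<lparr>carrier := A\<rparr>) f"
  using inj_on_subset[OF inj assms] assms
  by unfold_locales (simp_all add: eq_equality le_iff subset_iff)

lemma order_representation_comp:
  fixes e :: "'b \<Rightarrow> 'c::order"
  assumes "\<And>s t. s \<in> f ` carrier P \<Longrightarrow> t \<in> f ` carrier P \<Longrightarrow> e s \<le> e t \<longleftrightarrow> s \<le> t"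
  shows "order_representation P (e \<circ> f)"
proof
  have "inj_on e (f ` carrier P)"
    using assms by (metis inj_onI order.antisym order.refl)
  then show "inj_on (e \<circ> f) (carrier P)"
    using inj by (rule comp_inj_on[rotated])
qed (use assms in \<open>auto simp: eq_equality le_iff\<close>)

end

lemma order_isomorphic_if_image_eq:
  assumes "order_representation P f" and "order_representation Q g"
    and image_eq: "f ` carrier P = g ` carrier Q"
  shows "order_isomorphic P Q"
proof -
  interpret P: order_representation P f by fact
  interpret Q: order_representation Q g by fact
  define h where "h = inv_into (carrier Q) g \<circ> f"
  have bij: "bij_betw h (carrier P) (carrier Q)"
    unfolding h_def using P.inj Q.inj image_eq
    by (metis bij_betw_imageI bij_betw_inv_into bij_betw_trans)
  have "g (h x) = f x" if "x \<in> carrier P" for x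
    unfolding h_def comp_def using that image_eq by (metis f_inv_into_f imageI)
  then have "order_emb P Q h"
    using bij_betw_apply[OF bij] P.weak_partial_order_axioms Q.weak_partial_order_axioms
    by (simp add: order_emb_def P.le_iff Q.le_iff)
  with bij show ?thesis
    by (auto simp: order_isomorphic_def)
qed

lemma order_representation_interval:
  assumes "order_representation P f"
  shows "order_representation (interval_order P a b) f"
proof -
  interpret order_representation P f by fact
  show ?thesis
    unfolding interval_order_def
    using at_least_at_most_closed by (rule order_representation_subset)
qed

lemma carrier_interval_order_least:
  assumes "least P b (carrier P)"
  shows "carrier (interval_order P b a) = {x \<in> carrier P. x \<sqsubseteq>\<^bsub>P\<^esub> a}"
  using assms by (auto simp: interval_order_def at_least_at_most_def least_def)

lemma partial_order_up_set_order: "partial_order (up_set_order Y)"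
proof -
  interpret order_representation "up_set_order Y" uminus
    by unfold_locales (auto simp: up_set_order_def inj_on_def)
  show ?thesis ..
qed

lemma mem_fuzzy_up_sets_iff:
  "\<mu> \<in> fuzzy_up_sets L Y \<longleftrightarrow>
    \<mu> \<in> carrier Y \<rightarrow> carrier L \<and> \<mu> \<in> extensional (carrier Y) \<and> isotone Y L \<mu>"
  by (auto simp: fuzzy_up_sets_def PiE_def)

lemma fuzzy_up_set_closed:
  assumes "\<mu> \<in> fuzzy_up_sets L Y" and "y \<in> carrier Y"
  shows "\<mu> y \<in> carrier L"
  using assms by (auto simp: mem_fuzzy_up_sets_iff)

lemma compose_in_fuzzy_up_sets:
  assumes "f \<in> carrier X \<rightarrow> carrier Y" "isotone X Y f"
    and "g \<in> carrier Y \<rightarrow> carrier L" "isotone Y L g"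
  shows "compose (carrier X) g f \<in> fuzzy_up_sets L X"
  using assms iso_compose[OF assms] funcset_compose[OF assms(1,3)]
  by (simp add: mem_fuzzy_up_sets_iff isotone_def compose_eq)

lemma cuts_subset_up_sets:
  assumes "\<mu> \<in> fuzzy_up_sets L Y"
  shows "cuts L Y \<mu> \<subseteq> up_sets Y"
proof -
  have isotone: "isotone Y L \<mu>"
    using assms by (simp add: mem_fuzzy_up_sets_iff)
  then interpret L: weak_partial_order L
    by (simp add: isotone_def)
  have "p \<sqsubseteq>\<^bsub>L\<^esub> \<mu> z"
    if "p \<in> carrier L" "p \<sqsubseteq>\<^bsub>L\<^esub> \<mu> y" "y \<in> carrier Y" "z \<in> carrier Y" "y \<sqsubseteq>\<^bsub>Y\<^esub> z" for p y z
    using L.le_trans[OF that(2) use_iso2[OF isotone that(3-5)]] that fuzzy_up_set_closed[OF assms] by simp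
  then show ?thesis
    by (auto simp: cuts_def cut_def up_sets_def)
qed

definition cuts_of_class ::
  "('l, 'm) gorder_scheme \<Rightarrow> ('a, 'n) gorder_scheme \<Rightarrow> ('a \<Rightarrow> 'l) set \<Rightarrow> 'a set set" where
  "cuts_of_class L Y A = (\<Union>\<mu>\<in>A. cuts L Y \<mu>)"

lemma cuts_of_class_fuzzy_class:
  assumes "\<mu> \<in> fuzzy_up_sets L Y"
  shows "cuts_of_class L Y (fuzzy_class L Y \<mu>) = cuts L Y \<mu>"
  using assms by (auto simp: cuts_of_class_def fuzzy_rel_def)

lemma carrier_fuzzy_quotient:
  "carrier (fuzzy_quotient L Y) = fuzzy_class L Y ` fuzzy_up_sets L Y"
  by (auto simp: fuzzy_quotient_def quotient_def)

lemma cuts_of_class_image: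
  "cuts_of_class L Y ` carrier (fuzzy_quotient L Y) = cuts L Y ` fuzzy_up_sets L Y"
  by (simp add: carrier_fuzzy_quotient image_image cuts_of_class_fuzzy_class)

lemma order_representation_fuzzy_quotient:
  "order_representation (fuzzy_quotient L Y) (cuts_of_class L Y)"
proof
  show "inj_on (cuts_of_class L Y) (carrier (fuzzy_quotient L Y))"
    by (auto simp: inj_on_def carrier_fuzzy_quotient cuts_of_class_fuzzy_class)
      (auto simp: fuzzy_rel_def)
  show "A \<sqsubseteq>\<^bsub>fuzzy_quotient L Y\<^esub> B \<longleftrightarrow> cuts_of_class L Y A \<subseteq> cuts_of_class L Y B"
    if "A \<in> carrier (fuzzy_quotient L Y)" "B \<in> carrier (fuzzy_quotient L Y)" for A B
    using that
    by (auto simp only: carrier_fuzzy_quotient fuzzy_quotient_le_iff cuts_of_class_fuzzy_class)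
qed (simp add: fuzzy_quotient_def)

lemma cuts_of_class_image_interval:
  assumes least: "least (fuzzy_quotient L Y) b (carrier (fuzzy_quotient L Y))"
    and \<mu>: "\<mu> \<in> fuzzy_up_sets L Y"
  shows "cuts_of_class L Y ` carrier (interval_order (fuzzy_quotient L Y) b (fuzzy_class L Y \<mu>))
    = cuts L Y ` {\<rho> \<in> fuzzy_up_sets L Y. cuts L Y \<rho> \<subseteq> cuts L Y \<mu>}"
proof -
  have "carrier (interval_order (fuzzy_quotient L Y) b (fuzzy_class L Y \<mu>))
      = fuzzy_class L Y ` {\<rho> \<in> fuzzy_up_sets L Y. cuts L Y \<rho> \<subseteq> cuts L Y \<mu>}"
    unfolding carrier_interval_order_least[OF least] carrier_fuzzy_quotient
    using \<mu> by (auto simp: fuzzy_quotient_le_iff)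
  then show ?thesis
    by (simp add: image_image cuts_of_class_fuzzy_class)
qed

lemma least_fuzzy_quotient:
  assumes "weak_partial_order Y" and "weak_partial_order_top L" and "weak_partial_order_bottom L"
  shows "least (fuzzy_quotient L Y) (fuzzy_class L Y (\<lambda>y\<in>carrier Y. \<top>\<^bsub>L\<^esub>))
    (carrier (fuzzy_quotient L Y))"
proof -
  interpret top: weak_partial_order_top L by fact
  interpret bottom: weak_partial_order_bottom L by fact
  define \<tau> where "\<tau> = (\<lambda>y\<in>carrier Y. \<top>\<^bsub>L\<^esub>)"
  have \<tau>: "\<tau> \<in> fuzzy_up_sets L Y"
    using assms(1) top.weak_partial_order_axioms
    by (auto simp: \<tau>_def fuzzy_up_sets_def isotone_def)
  have "cuts L Y \<tau> \<subseteq> {carrier Y}"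
    by (auto simp: cuts_def cut_def \<tau>_def)
  moreover have "carrier Y \<in> cuts L Y \<nu>" if "\<nu> \<in> fuzzy_up_sets L Y" for \<nu>
  proof -
    have "cut L Y \<nu> \<bottom>\<^bsub>L\<^esub> = carrier Y"
      using that by (auto simp: cut_def fuzzy_up_sets_def)
    then show ?thesis
      by (auto simp: cuts_def)
  qed
  ultimately have "cuts L Y \<tau> \<subseteq> cuts L Y \<nu>" if "\<nu> \<in> fuzzy_up_sets L Y" for \<nu>
    using that by blast
  then show ?thesis
    unfolding \<tau>_def[symmetric] least_def carrier_fuzzy_quotient
    using \<tau> by (auto simp only: fuzzy_quotient_le_iff)
qed

lemma least_bottom_fuzzy_quotient:
  assumes "weak_partial_order Y" and "weak_partial_order_top L" and "weak_partial_order_bottom L"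
  shows "least (fuzzy_quotient L Y) \<bottom>\<^bsub>fuzzy_quotient L Y\<^esub> (carrier (fuzzy_quotient L Y))"
  unfolding bottom_def using least_fuzzy_quotient[OF assms] by (rule someI)

lemma coretractI:
  assumes "partial_order A" and "partial_order B"
    and "h \<in> carrier A \<rightarrow> carrier B" and "g \<in> carrier B \<rightarrow> carrier A"
    and "\<And>x y. x \<in> carrier A \<Longrightarrow> y \<in> carrier B \<Longrightarrow> h x \<sqsubseteq>\<^bsub>B\<^esub> y \<longleftrightarrow> x \<sqsubseteq>\<^bsub>A\<^esub> g y"
    and "\<And>y. y \<in> carrier B \<Longrightarrow> y \<sqsubseteq>\<^bsub>B\<^esub> h (g y)"
  shows "coretract \<lparr>orderA = A, orderB = B, lower = h, upper = g\<rparr>"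
  using assms by (simp add: coretract_def coretract_axioms_def galois_connection_def
      galois_connection_axioms_def connection_def)

lemma (in coretract) ex_fuzzy_up_set_same_cuts:
  assumes "\<nu> \<in> fuzzy_up_sets \<Y> Y"
  shows "\<exists>\<mu>\<in>fuzzy_up_sets \<X> Y. cuts \<X> Y \<mu> = cuts \<Y> Y \<nu>"
proof
  have \<nu>: "\<nu> \<in> carrier Y \<rightarrow> carrier \<Y>" "isotone Y \<Y> \<nu>"
    using assms by (simp_all add: mem_fuzzy_up_sets_iff)
  then show "compose (carrier Y) \<pi>\<^sub>* \<nu> \<in> fuzzy_up_sets \<X> Y"
    using upper_closure upper_iso by (rule compose_in_fuzzy_up_sets)
  have "cut \<X> Y (compose (carrier Y) \<pi>\<^sub>* \<nu>) p = cut \<Y> Y \<nu> (\<pi>\<^sup>* p)" if "p \<in> carrier \<X>" for p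
    using galois_property[OF that] \<nu>(1) by (auto simp: cut_def compose_eq Pi_iff)
  then have "cuts \<X> Y (compose (carrier Y) \<pi>\<^sub>* \<nu>) = cut \<Y> Y \<nu> ` \<pi>\<^sup>* ` carrier \<X>"
    by (simp add: cuts_def image_image)
  also have "\<pi>\<^sup>* ` carrier \<X> = carrier \<Y>"
  proof
    show "carrier \<Y> \<subseteq> \<pi>\<^sup>* ` carrier \<X>"
      using upper_closed by (force intro: coretract_inverse[symmetric])
  qed (use lower_closed in blast)
  finally show "cuts \<X> Y (compose (carrier Y) \<pi>\<^sub>* \<nu>) = cuts \<Y> Y \<nu>"
    by (simp add: cuts_def)
qed

definition principal_up_set :: "('a, 'm) gorder_scheme \<Rightarrow> 'a \<Rightarrow> 'a set" where
  "principal_up_set Y y = {z \<in> carrier Y. y \<sqsubseteq>\<^bsub>Y\<^esub> z}"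

context weak_partial_order
begin

lemma principal_up_set_in_up_sets:
  assumes "y \<in> carrier L"
  shows "principal_up_set L y \<in> up_sets L"
  using assms le_trans[of y] by (auto simp: principal_up_set_def up_sets_def)

lemma principal_up_set_antimono:
  assumes "y \<sqsubseteq> z" "y \<in> carrier L" "z \<in> carrier L"
  shows "principal_up_set L z \<subseteq> principal_up_set L y"
  using assms le_trans[of y z] by (auto simp: principal_up_set_def)

lemma principal_up_set_subset_iff:
  assumes "U \<in> up_sets L" "y \<in> carrier L"
  shows "principal_up_set L y \<subseteq> U \<longleftrightarrow> y \<in> U"
  using assms by (auto simp: principal_up_set_def up_sets_def)

lemma principal_fuzzy_up_set:
  "(\<lambda>y\<in>carrier L. principal_up_set L y) \<in> fuzzy_up_sets (up_set_order L) L"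
proof -
  interpret U: partial_order "up_set_order L" by (rule partial_order_up_set_order)
  show ?thesis
    using principal_up_set_in_up_sets principal_up_set_antimono
      weak_partial_order_axioms U.weak_partial_order_axioms
    by (simp add: fuzzy_up_sets_def isotone_def up_set_order_def)
qed

lemma cuts_principal_fuzzy_up_set:
  "cuts (up_set_order L) L (\<lambda>y\<in>carrier L. principal_up_set L y) = up_sets L"
proof -
  have "cut (up_set_order L) L (\<lambda>y\<in>carrier L. principal_up_set L y) U = U" if "U \<in> up_sets L" for U
    using that principal_up_set_subset_iff[OF that]
    by (auto simp: cut_def up_set_order_def) (auto simp: up_sets_def)
  then show ?thesis
    by (simp add: cuts_def up_set_order_def)
qed

end

locale isotone_surjection =
  fixes X :: "('a, 'm) gorder_scheme" and Q :: "('b, 'n) gorder_scheme" and f :: "'a \<Rightarrow> 'b"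
  assumes isotone: "isotone X Q f"
    and surj: "f ` carrier X = carrier Q"

sublocale isotone_surjection \<subseteq> Q: weak_partial_order Q
  using isotone by (simp add: isotone_def)

context isotone_surjection
begin

abbreviation preimage :: "'b set \<Rightarrow> 'a set" where
  "preimage T \<equiv> f -` T \<inter> carrier X"

abbreviation pullback :: "('b \<Rightarrow> 'l) \<Rightarrow> 'a \<Rightarrow> 'l" where
  "pullback \<nu> \<equiv> compose (carrier X) \<nu> f"

lemma image_closed: "x \<in> carrier X \<Longrightarrow> f x \<in> carrier Q"
  using surj by blast

lemma preimage_in_up_sets:
  assumes "T \<in> up_sets Q"
  shows "preimage T \<in> up_sets X"
  using assms image_closed use_iso2[OF isotone] by (auto simp: up_sets_def)

lemma inj_on_preimage: "inj_on preimage (Pow (carrier Q))"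
  unfolding surj[symmetric] by (rule inj_on_inverseI[where g = "(`) f"]) blast

lemma preimage_image_subset_iff:
  assumes "\<S> \<subseteq> Pow (carrier Q)" and "\<T> \<subseteq> Pow (carrier Q)"
  shows "preimage ` \<S> \<subseteq> preimage ` \<T> \<longleftrightarrow> \<S> \<subseteq> \<T>"
proof -
  have "preimage S \<in> preimage ` \<T> \<longleftrightarrow> S \<in> \<T>" if "S \<in> \<S>" for S
    using that assms by (intro inj_on_image_mem_iff[OF inj_on_preimage]) auto
  then show ?thesis
    unfolding image_subset_iff by (simp add: subset_eq)
qed

lemma coretract_preimage:
  "coretract \<lparr>orderA = up_set_order X, orderB = up_set_order Q,
    lower = \<lambda>U. {q \<in> carrier Q. preimage (principal_up_set Q q) \<subseteq> U}, upper = preimage\<rparr>"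
proof -
  let ?lower = "\<lambda>U. {q \<in> carrier Q. preimage (principal_up_set Q q) \<subseteq> U}"
  have lower_in_up_sets: "?lower U \<in> up_sets Q" for U
    using Q.principal_up_set_antimono by (fastforce simp: up_sets_def)
  have preimage_principal: "x \<in> preimage (principal_up_set Q (f x))" if "x \<in> carrier X" for x
    using that image_closed by (simp add: principal_up_set_def)
  have adjoint: "T \<subseteq> ?lower U \<longleftrightarrow> preimage T \<subseteq> U" if T: "T \<in> up_sets Q" for T U
  proof
    assume "T \<subseteq> ?lower U"
    then show "preimage T \<subseteq> U"
      using preimage_principal by blast
  next
    assume "preimage T \<subseteq> U"
    moreover have "T \<subseteq> carrier Q"
      using T by (auto simp: up_sets_def)
    ultimately show "T \<subseteq> ?lower U"
      using Q.principal_up_set_subset_iff[OF T] by blast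
  qed
  have "?lower (preimage T) \<subseteq> T" for T
    using preimage_principal unfolding surj[symmetric] by blast
  with lower_in_up_sets adjoint preimage_in_up_sets show ?thesis
    by (intro coretractI partial_order_up_set_order) (simp_all add: up_set_order_def)
qed

lemma pullback_in_fuzzy_up_sets:
  assumes "\<nu> \<in> fuzzy_up_sets L Q"
  shows "pullback \<nu> \<in> fuzzy_up_sets L X"
  using assms isotone image_closed
  by (intro compose_in_fuzzy_up_sets) (auto simp: mem_fuzzy_up_sets_iff)

lemma cuts_pullback: "cuts L X (pullback \<nu>) = preimage ` cuts L Q \<nu>"
proof -
  have "cut L X (pullback \<nu>) p = preimage (cut L Q \<nu> p)" for p
    using image_closed by (auto simp: cut_def compose_eq)
  then show ?thesis
    by (simp add: cuts_def image_image)
qed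

lemma pullback_factorization:
  assumes "partial_order L" and \<rho>: "\<rho> \<in> fuzzy_up_sets L X"
    and le_if_image_le: "\<And>x y. x \<in> carrier X \<Longrightarrow> y \<in> carrier X \<Longrightarrow>
      f x \<sqsubseteq>\<^bsub>Q\<^esub> f y \<Longrightarrow> \<rho> x \<sqsubseteq>\<^bsub>L\<^esub> \<rho> y"
  shows "\<rho> \<in> pullback ` fuzzy_up_sets L Q"
proof -
  interpret L: partial_order L by fact
  note \<rho>_closed = fuzzy_up_set_closed[OF \<rho>]
  define \<nu> where "\<nu> = (\<lambda>q\<in>carrier Q. \<rho> (inv_into (carrier X) f q))"
  have \<nu>_f: "\<nu> (f x) = \<rho> x" if x: "x \<in> carrier X" for x
  proof -
    define y where "y = inv_into (carrier X) f (f x)"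
    have y: "y \<in> carrier X" "f y = f x"
      using x by (auto simp: y_def inv_into_into f_inv_into_f)
    then have "\<rho> y = \<rho> x"
      using x image_closed \<rho>_closed by (intro L.le_antisym le_if_image_le) auto
    then show ?thesis
      using x image_closed by (simp add: \<nu>_def y_def)
  qed
  have "\<nu> \<in> carrier Q \<rightarrow> carrier L"
    using \<nu>_f \<rho>_closed by (auto simp flip: surj)
  moreover have "isotone Q L \<nu>"
    using Q.weak_partial_order_axioms L.weak_partial_order_axioms
    by (rule isotoneI) (use \<nu>_f le_if_image_le in \<open>auto simp flip: surj\<close>)
  ultimately have "\<nu> \<in> fuzzy_up_sets L Q"
    by (simp add: mem_fuzzy_up_sets_iff \<nu>_def)
  moreover have "pullback \<nu> = \<rho>"
  proof (rule extensionalityI)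
    show "\<rho> \<in> extensional (carrier X)"
      using \<rho> by (simp add: mem_fuzzy_up_sets_iff)
  qed (simp_all add: compose_eq \<nu>_f)
  ultimately show ?thesis
    by blast
qed

lemma pullback_image:
  assumes "partial_order L"
  shows "pullback ` fuzzy_up_sets L Q = {\<rho> \<in> fuzzy_up_sets L X. cuts L X \<rho> \<subseteq> preimage ` up_sets Q}"
proof (intro Set.equalityI subsetI)
  fix \<rho> assume "\<rho> \<in> pullback ` fuzzy_up_sets L Q"
  then show "\<rho> \<in> {\<rho> \<in> fuzzy_up_sets L X. cuts L X \<rho> \<subseteq> preimage ` up_sets Q}"
    using pullback_in_fuzzy_up_sets cuts_subset_up_sets by (fastforce simp: cuts_pullback)
next
  interpret L: partial_order L by fact
  fix \<rho> assume "\<rho> \<in> {\<rho> \<in> fuzzy_up_sets L X. cuts L X \<rho> \<subseteq> preimage ` up_sets Q}"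
  then have \<rho>: "\<rho> \<in> fuzzy_up_sets L X" and cuts: "cuts L X \<rho> \<subseteq> preimage ` up_sets Q"
    by simp_all
  have "\<rho> x \<sqsubseteq>\<^bsub>L\<^esub> \<rho> y" if x: "x \<in> carrier X" and y: "y \<in> carrier X" and "f x \<sqsubseteq>\<^bsub>Q\<^esub> f y" for x y
  proof -
    have \<rho>_x: "\<rho> x \<in> carrier L"
      using \<rho> x by (rule fuzzy_up_set_closed)
    with cuts obtain T where T: "T \<in> up_sets Q" and cut: "cut L X \<rho> (\<rho> x) = preimage T"
      by (auto simp: cuts_def)
    have "x \<in> preimage T"
      unfolding cut[symmetric] using x \<rho>_x by (simp add: cut_def)
    then have "y \<in> preimage T"
      using T y image_closed \<open>f x \<sqsubseteq>\<^bsub>Q\<^esub> f y\<close> by (auto simp: up_sets_def)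
    then show ?thesis
      unfolding cut[symmetric] by (simp add: cut_def)
  qed
  with assms \<rho> show "\<rho> \<in> pullback ` fuzzy_up_sets L Q"
    by (rule pullback_factorization)
qed

lemma fuzzy_quotient_isomorphic_interval:
  assumes "partial_order L" and least: "least (fuzzy_quotient L X) b (carrier (fuzzy_quotient L X))"
    and \<mu>: "\<mu> \<in> fuzzy_up_sets L X" and cuts_\<mu>: "cuts L X \<mu> = preimage ` up_sets Q"
  shows "order_isomorphic (fuzzy_quotient L Q)
    (interval_order (fuzzy_quotient L X) b (fuzzy_class L X \<mu>))"
proof (rule order_isomorphic_if_image_eq)
  let ?I = "interval_order (fuzzy_quotient L X) b (fuzzy_class L X \<mu>)"
  interpret FQ: order_representation "fuzzy_quotient L Q" "cuts_of_class L Q"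
    by (rule order_representation_fuzzy_quotient)
  show "order_representation (fuzzy_quotient L Q) ((`) preimage \<circ> cuts_of_class L Q)"
  proof (rule FQ.order_representation_comp)
    fix \<S> \<T>
    assume "\<S> \<in> cuts_of_class L Q ` carrier (fuzzy_quotient L Q)"
      and "\<T> \<in> cuts_of_class L Q ` carrier (fuzzy_quotient L Q)"
    then have "\<S> \<subseteq> Pow (carrier Q)" and "\<T> \<subseteq> Pow (carrier Q)"
      by (auto simp: cuts_of_class_image cuts_def cut_def)
    then show "preimage ` \<S> \<subseteq> preimage ` \<T> \<longleftrightarrow> \<S> \<subseteq> \<T>"
      by (rule preimage_image_subset_iff)
  qed
  show "order_representation ?I (cuts_of_class L X)"
    using order_representation_fuzzy_quotient by (rule order_representation_interval)
  have "((`) preimage \<circ> cuts_of_class L Q) ` carrier (fuzzy_quotient L Q)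
      = (`) preimage ` cuts L Q ` fuzzy_up_sets L Q"
    by (simp only: image_comp[symmetric] cuts_of_class_image)
  also have "\<dots> = cuts L X ` pullback ` fuzzy_up_sets L Q"
    by (simp add: image_image cuts_pullback)
  also have "\<dots> = cuts L X ` {\<rho> \<in> fuzzy_up_sets L X. cuts L X \<rho> \<subseteq> cuts L X \<mu>}"
    using assms(1) by (simp only: pullback_image cuts_\<mu>)
  also have "\<dots> = cuts_of_class L X ` carrier ?I"
    using least \<mu> by (rule cuts_of_class_image_interval[symmetric])
  finally show "((`) preimage \<circ> cuts_of_class L Q) ` carrier (fuzzy_quotient L Q)
    = cuts_of_class L X ` carrier ?I" .
qed

lemma ex_fuzzy_up_set_cuts_eq_preimages:
  assumes "coretract \<lparr>orderA = L, orderB = up_set_order X, lower = h, upper = g\<rparr>"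
  shows "\<exists>\<mu>\<in>fuzzy_up_sets L X. cuts L X \<mu> = preimage ` up_sets Q"
proof -
  have "\<exists>\<nu>\<in>fuzzy_up_sets (up_set_order X) Q. cuts (up_set_order X) Q \<nu> = up_sets Q"
    using coretract.ex_fuzzy_up_set_same_cuts[OF coretract_preimage, of _ Q]
      Q.principal_fuzzy_up_set Q.cuts_principal_fuzzy_up_set by force
  then obtain \<nu> where "\<nu> \<in> fuzzy_up_sets L Q" "cuts L Q \<nu> = up_sets Q"
    using coretract.ex_fuzzy_up_set_same_cuts[OF assms, of _ Q] by force
  then show ?thesis
    using pullback_in_fuzzy_up_sets cuts_pullback by metis
qed

end

abbreviation closure_class :: "('a, 'm) gorder_scheme \<Rightarrow> ('a \<Rightarrow> 'a) \<Rightarrow> 'a \<Rightarrow> 'a set" where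
  "closure_class P C x \<equiv> closure_rel P C `` {x}"

lemma carrier_closure_quotient:
  "carrier (closure_quotient P C) = closure_class P C ` carrier P"
  by (auto simp: closure_quotient_def quotient_def)

lemma Union_closure_classes:
  assumes "T \<subseteq> carrier (closure_quotient P C)"
  shows "\<Union>T = closure_class P C -` T \<inter> carrier P"
proof -
  have "A = closure_class P C x" "x \<in> carrier P" if "A \<in> T" "x \<in> A" for A x
    using that assms by (auto simp: carrier_closure_quotient closure_rel_def)
  moreover have "x \<in> closure_class P C x" if "x \<in> carrier P" for x
    using that by (simp add: closure_rel_def)
  ultimately show ?thesis
    by blast
qed

lemma saturated_up_sets_eq_preimages:
  "saturated_up_sets P C =
    (\<lambda>T. closure_class P C -` T \<inter> carrier P) ` up_sets (closure_quotient P C)"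
proof -
  have "\<Union>T = closure_class P C -` T \<inter> carrier P" if "T \<in> up_sets (closure_quotient P C)" for T
    using that by (intro Union_closure_classes) (simp add: up_sets_def)
  then show ?thesis
    by (simp add: saturated_up_sets_def setcompr_eq_image cong: image_cong)
qed

lemma isotone_surjection_closure_class:
  assumes "partial_order P" and "closure_operator P C"
  shows "isotone_surjection P (closure_quotient P C) (closure_class P C)"
proof
  interpret P: partial_order P by fact
  interpret Q: partial_order "closure_quotient P C"
    using assms by (rule partial_order_closure_quotient)
  have "isotone P P C"
    using assms(2) by (simp add: closure_operator_def)
  then show "isotone P (closure_quotient P C) (closure_class P C)"
    using P.weak_partial_order_axioms Q.weak_partial_order_axioms
    by (simp add: isotone_def closure_quotient_le_iff)
qed (simp add: carrier_closure_quotient)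

lemma closure_operator_closed:
  assumes "closure_operator P C" and "x \<in> carrier P"
  shows "C x \<in> carrier P"
  using assms by (auto simp: closure_operator_def)

lemma (in partial_order) closure_operator_idem:
  assumes "closure_operator L C" and "x \<in> carrier L"
  shows "C (C x) = C x"
  using assms by (simp add: closure_operator_def idempotent_def eq_is_equal)

lemma (in partial_order) closure_class_closure:
  assumes "closure_operator L C" and "x \<in> carrier L"
  shows "closure_class L C (C x) = closure_class L C x"
  using assms by (auto simp: closure_rel_def closure_operator_closed closure_operator_idem)

lemma (in partial_order) le_closure_iff:
  assumes C: "closure_operator L C" and x: "x \<in> carrier L" and y: "y \<in> carrier L"
  shows "x \<sqsubseteq> C y \<longleftrightarrow> C x \<sqsubseteq> C y"
proof
  note closed = closure_operator_closed[OF C]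
  show "x \<sqsubseteq> C y" if "C x \<sqsubseteq> C y"
  proof -
    have "x \<sqsubseteq> C x"
      using C x by (simp add: closure_operator_def)
    then show ?thesis
      using that x closed[OF x] closed[OF y] by (rule le_trans)
  qed
  show "C x \<sqsubseteq> C y" if "x \<sqsubseteq> C y"
  proof -
    have "C x \<sqsubseteq> C (C y)"
      using that C x closed[OF y] by (simp add: closure_operator_def isotone_def)
    then show ?thesis
      using C y by (simp add: closure_operator_idem)
  qed
qed

lemma closure_quotient_isomorphic_coretract:
  assumes "partial_order L" and "partial_order M" and D: "closure_operator L D"
    and iso: "order_isomorphic (closure_quotient L D) M"
  obtains h g where "coretract \<lparr>orderA = L, orderB = M, lower = h, upper = g\<rparr>"
proof -
  interpret L: partial_order L by fact
  interpret M: partial_order M by fact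
  obtain i where bij: "bij_betw i (carrier (closure_quotient L D)) (carrier M)"
    and emb: "order_emb (closure_quotient L D) M i"
    using iso by (auto simp: order_isomorphic_def)
  define h where "h p = i (closure_class L D p)" for p
  define r where "r = inv_into (carrier L) h"
  have h_image: "h ` carrier L = carrier M"
    using bij by (simp add: h_def bij_betw_def carrier_closure_quotient image_image)
  then have r: "r m \<in> carrier L" "h (r m) = m" if "m \<in> carrier M" for m
    using that by (auto simp: r_def inv_into_into f_inv_into_f)
  have h_le_iff: "h p \<sqsubseteq>\<^bsub>M\<^esub> h q \<longleftrightarrow> p \<sqsubseteq>\<^bsub>L\<^esub> D q" if "p \<in> carrier L" "q \<in> carrier L" for p q
    using emb that by (simp add: h_def order_emb_def carrier_closure_quotient
        closure_quotient_le_iff L.le_closure_iff[OF D])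
  have "coretract \<lparr>orderA = L, orderB = M, lower = h, upper = \<lambda>m. D (r m)\<rparr>"
  proof (rule coretractI[OF assms(1,2)])
    show "h p \<sqsubseteq>\<^bsub>M\<^esub> m \<longleftrightarrow> p \<sqsubseteq>\<^bsub>L\<^esub> D (r m)" if "p \<in> carrier L" "m \<in> carrier M" for p m
      using h_le_iff[of p "r m"] r that by simp
    show "m \<sqsubseteq>\<^bsub>M\<^esub> h (D (r m))" if "m \<in> carrier M" for m
      using that r L.closure_class_closure[OF D] by (simp add: h_def)
  qed (use h_image r D in \<open>auto intro: closure_operator_closed\<close>)
  then show thesis
    by (rule that)
qed

theorem theorem7:
  fixes X :: "('a, 'm) gorder_scheme" and L :: "('l, 'n) gorder_scheme" and C :: "'a \<Rightarrow> 'a"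
  assumes "partial_order X"
    and "closure_operator X C"
    and "complete_lattice L"
    and "\<exists>C\<^sub>1. closure_operator L C\<^sub>1 \<and>
           order_isomorphic (closure_quotient L C\<^sub>1) (up_set_order X)"
  shows "least (fuzzy_quotient L X) \<bottom>\<^bsub>fuzzy_quotient L X\<^esub> (carrier (fuzzy_quotient L X)) \<and>
    (\<exists>\<mu>\<in>fuzzy_up_sets L X. cuts L X \<mu> = saturated_up_sets X C) \<and>
    (\<forall>\<mu>\<in>fuzzy_up_sets L X. cuts L X \<mu> = saturated_up_sets X C \<longrightarrow>
       order_isomorphic
         (fuzzy_quotient L (closure_quotient X C))
         (interval_order (fuzzy_quotient L X) \<bottom>\<^bsub>fuzzy_quotient L X\<^esub> (fuzzy_class L X \<mu>)))"
proof -
  interpret X: partial_order X by fact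
  interpret L: complete_lattice L by fact
  interpret proj: isotone_surjection X "closure_quotient X C" "closure_class X C"
    using assms(1,2) by (rule isotone_surjection_closure_class)
  have least: "least (fuzzy_quotient L X) \<bottom>\<^bsub>fuzzy_quotient L X\<^esub> (carrier (fuzzy_quotient L X))"
    by (rule least_bottom_fuzzy_quotient) unfold_locales
  obtain h g where "coretract \<lparr>orderA = L, orderB = up_set_order X, lower = h, upper = g\<rparr>"
    using assms(4) L.partial_order_axioms
    by (metis closure_quotient_isomorphic_coretract partial_order_up_set_order)
  then have "\<exists>\<mu>\<in>fuzzy_up_sets L X. cuts L X \<mu> = saturated_up_sets X C"
    unfolding saturated_up_sets_eq_preimages by (rule proj.ex_fuzzy_up_set_cuts_eq_preimages)
  with least show ?thesis
    using proj.fuzzy_quotient_isomorphic_interval[OF L.partial_order_axioms least]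
    by (simp add: saturated_up_sets_eq_preimages)
qed

end
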